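(* For any integers $k\ge 3$ and $t\ge 1$, there exists a colour-balanced $k$-edge-colouring of the complete graph $K_{2kt}$ with no colour-balanced perfect matching.
   Context: A $k$-edge-colouring is an arbitrary (not necessarily proper) map from the edge set to $[k]=\{1,\dots,k\}$; it is colour-balanced if all $k$ colour classes have the same size. A perfect matching is colour-balanced if each of the $k$ colours appears on equally many of its edges (here exactly $t$ each). *)

theory Defs
  imports "HOL-Library.Ramsey"
begin

text \<open>
  Simple graphs are given by their set of edges, an edge being a two-element set of vertices.
  The notation \<open>[V]\<^bsup>2\<^esup>\<close> (constant \<open>nsets\<close>) is the set of all two-element subsets of \<open>V\<close>.
\<close>

definition complete_graph_edges :: "nat \<Rightarrow> nat set set" where
  "complete_graph_edges n = [{..<n}]\<^bsup>2\<^esup>"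

text \<open>The colour of something that is not an edge is irrelevant. No properness is required.\<close>

definition edge_colouring :: "nat \<Rightarrow> 'v set set \<Rightarrow> ('v set \<Rightarrow> nat) \<Rightarrow> bool" where
  "edge_colouring k E c \<longleftrightarrow> c \<in> E \<rightarrow> {1..k}"

text \<open>
  Applied to the edge set of the whole graph this says that the colouring is colour-balanced;
  applied to a matching it says that the matching is. It is meant for finite \<open>F\<close>. Colours in
  \<open>{1..k}\<close> that do not occur on \<open>F\<close> count as well, with an empty class.
\<close>

definition colour_balanced :: "nat \<Rightarrow> ('v set \<Rightarrow> nat) \<Rightarrow> 'v set set \<Rightarrow> bool" where
  "colour_balanced k c F \<longleftrightarrow>
     (\<forall>i\<in>{1..k}. \<forall>j\<in>{1..k}. card {e \<in> F. c e = i} = card {e \<in> F. c e = j})"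

definition perfect_matching :: "'v set \<Rightarrow> 'v set set \<Rightarrow> 'v set set \<Rightarrow> bool" where
  "perfect_matching V E M \<longleftrightarrow> M \<subseteq> E \<and> (\<forall>v\<in>V. \<exists>!e. e \<in> M \<and> v \<in> e)"

end

theory Submission
  imports Defs "HOL-Combinatorics.Transposition" "HOL-Number_Theory.Cong"
begin

text \<open>
  Single out the vertex \<open>0\<close> and colour an edge between two other vertices \<open>i\<close>, \<open>j\<close> by the residue of
  \<open>i + j\<close> modulo \<open>k\<close>. The residues of the colours of a balanced perfect matching add up to a fixed
  value modulo \<open>k\<close>, and so do the vertices it covers; hence the colour of its edge \<open>{0, u}\<close> is a
  residue \<open>f u\<close> determined by \<open>u\<close>. It therefore suffices to avoid the colour \<open>f u\<close> on every edge
  \<open>{0, u}\<close>. The sum colouring is close enough to balanced for the edges at \<open>0\<close> to restore the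
  balance under this restriction.
\<close>

section \<open>Counting residues modulo \<open>k\<close>\<close>

text \<open>Each block of \<open>k\<close> consecutive values of \<open>j\<close> contributes
  exactly one solution; the induction adds one block at a time.\<close>

lemma card_mod_fibre:
  fixes k m i c :: nat
  assumes "c < k"
  shows "card {j. j < m * k \<and> (i + j) mod k = c} = m"
proof (induction m)
  case 0
  then show ?case by simp
next
  case (Suc m)
  \<comment> \<open>The residue of \<open>c - i\<close>; subtracting \<open>i mod k\<close> from
    \<open>k\<close> keeps the subtraction of naturals from truncating.\<close>
  define r where "r = (c + (k - i mod k)) mod k"
  have k: "0 < k" using assms by simp
  have rk: "r < k" using k by (simp add: r_def)
  have "(i + r) mod k = (i mod k + (c + (k - i mod k))) mod k"
    unfolding r_def by (simp add: mod_simps)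
  also have "i mod k + (c + (k - i mod k)) = c + k"
    using mod_less_divisor[OF k, of i] by linarith
  finally have r: "(i + r) mod k = c" using assms by simp
  have uniq: "s = r" if "s < k" "(i + s) mod k = c" for s
  proof -
    have "[i + s = i + r] (mod k)" using that r by (simp add: cong_def)
    then have "[s = r] (mod k)" by (simp add: cong_add_lcancel_nat)
    then show ?thesis using that rk by (simp add: cong_def)
  qed
  have split: "{j. j < Suc m * k \<and> (i + j) mod k = c} =
      insert (m * k + r) {j. j < m * k \<and> (i + j) mod k = c}"
  proof (intro equalityI subsetI)
    fix j assume j: "j \<in> {j. j < Suc m * k \<and> (i + j) mod k = c}"
    show "j \<in> insert (m * k + r) {j. j < m * k \<and> (i + j) mod k = c}"
    proof (cases "j < m * k")
      case False
      then obtain s where s: "j = m * k + s" using le_Suc_ex not_less by blast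
      have "(i + j) mod k = (i + s) mod k"
        unfolding s by (metis add.left_commute mod_mult_self3)
      then have "s = r" using j s by (intro uniq) auto
      then show ?thesis using s by simp
    qed (use j in auto)
  next
    fix j assume "j \<in> insert (m * k + r) {j. j < m * k \<and> (i + j) mod k = c}"
    moreover have "(i + (m * k + r)) mod k = c"
      using r by (metis add.left_commute mod_mult_self3)
    ultimately show "j \<in> {j. j < Suc m * k \<and> (i + j) mod k = c}"
      using rk by auto
  qed
  show ?case unfolding split using Suc by (subst card_insert_disjoint) auto
qed

text \<open>Doubling is at most two-to-one on residues: if \<open>x < k\<close> and
  \<open>x + x\<close> has residue \<open>c\<close>, then \<open>x + x\<close> is \<open>c\<close>
  or \<open>c + k\<close>. This bounds the diagonal pairs discarded when edges are counted.\<close>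

lemma card_double_mod_fibre_le:
  fixes k m c :: nat
  assumes "c < k"
  shows "card {j. j < m * k \<and> (j + j) mod k = c} \<le> 2 * m"
proof -
  let ?F = "\<lambda>c. {j. j < m * k \<and> (0 + j) mod k = c}"
  have k: "0 < k" using assms by simp
  have "{j. j < m * k \<and> (j + j) mod k = c} \<subseteq> ?F (c div 2) \<union> ?F ((c + k) div 2)"
  proof
    fix j assume j: "j \<in> {j. j < m * k \<and> (j + j) mod k = c}"
    define x where "x = j mod k"
    have x: "x < k" "(x + x) mod k = c"
      using j k by (auto simp: x_def mod_simps)
    have "x + x = c \<or> x + x = c + k"
    proof (cases "x + x < k")
      case False
      then have "(x + x) mod k = x + x - k" using x(1) by (subst mod_if) auto
      then show ?thesis using x(2) False by auto
    qed (use x in auto)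
    then show "j \<in> ?F (c div 2) \<union> ?F ((c + k) div 2)"
      using j by (auto simp: x_def)
  qed
  then have "card {j. j < m * k \<and> (j + j) mod k = c}
      \<le> card (?F (c div 2) \<union> ?F ((c + k) div 2))"
    by (intro card_mono) auto
  also have "\<dots> \<le> card (?F (c div 2)) + card (?F ((c + k) div 2))"
    by (rule card_Un_le)
  also have "\<dots> = 2 * m"
    using assms by (subst (1 2) card_mod_fibre) auto
  finally show ?thesis .
qed

section \<open>Maps with prescribed fibre sizes\<close>

text \<open>Place \<open>d c\<close> points above each \<open>c\<close>. The disjoint union has as
  many points as \<open>U\<close>, and a bijection from \<open>U\<close> onto it followed by the
  first projection is the required map.\<close>

lemma exists_map_with_fibre_cards:
  fixes d :: "'b \<Rightarrow> nat"
  assumes "finite U" "finite K" "sum d K = card U"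
  obtains g where "g \<in> U \<rightarrow> K" "\<And>c. c \<in> K \<Longrightarrow> card {u \<in> U. g u = c} = d c"
proof -
  let ?S = "Sigma K (\<lambda>c. {..<d c})"
  have "card ?S = card U" using assms by simp
  then obtain h where h: "bij_betw h U ?S"
    using assms finite_same_card_bij[of U ?S] by auto
  show thesis
  proof
    show "fst \<circ> h \<in> U \<rightarrow> K" using h by (auto dest!: bij_betwE)
    fix c assume c: "c \<in> K"
    have img: "h ` {u \<in> U. (fst \<circ> h) u = c} = {c} \<times> {..<d c}"
    proof (intro equalityI subsetI)
      fix p assume p: "p \<in> {c} \<times> {..<d c}"
      then have "p \<in> h ` U" using h c by (auto simp: bij_betw_def)
      then obtain u where "u \<in> U" "p = h u" by blast
      then show "p \<in> h ` {u \<in> U. (fst \<circ> h) u = c}" using p by (intro image_eqI) auto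
    next
      fix p assume "p \<in> h ` {u \<in> U. (fst \<circ> h) u = c}"
      then have "p \<in> ?S" "fst p = c" using h by (auto dest!: bij_betwE)
      then show "p \<in> {c} \<times> {..<d c}" by auto
    qed
    have "inj_on h {u \<in> U. (fst \<circ> h) u = c}"
      using h by (auto simp: bij_betw_def inj_on_def)
    from card_image[OF this] show "card {u \<in> U. (fst \<circ> h) u = c} = d c"
      unfolding img by simp
  qed
qed

lemma exists_avoiding_map_with_fibre_cards:
  fixes f :: "'a \<Rightarrow> 'b" and d :: "'b \<Rightarrow> nat"
  assumes fin: "finite U" "finite K" and sum: "sum d K = card U"
    and le: "\<And>c. c \<in> K \<Longrightarrow> card {u \<in> U. f u = c} + d c \<le> card U"
  obtains g where "g \<in> U \<rightarrow> K" "\<And>c. c \<in> K \<Longrightarrow> card {u \<in> U. g u = c} = d c"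
    and "\<And>u. u \<in> U \<Longrightarrow> g u \<noteq> f u"
proof -
  \<comment> \<open>A map agreeing with \<open>f\<close> at \<open>u\<close> can exchange its value there with a point where neither
    map takes the value \<open>f u\<close>; this lowers the number of agreements.\<close>
  define G where "G g \<longleftrightarrow> g \<in> U \<rightarrow> K \<and> (\<forall>c\<in>K. card {u \<in> U. g u = c} = d c)" for g
  define bad where "bad g = {u \<in> U. g u = f u}" for g
  obtain g where "G g"
    using exists_map_with_fibre_cards[OF fin sum] unfolding G_def by metis
  then obtain g where G: "G g" and min: "\<And>g'. G g' \<Longrightarrow> card (bad g) \<le> card (bad g')"
    using ex_has_least_nat[of G g "\<lambda>g. card (bad g)"] by blast
  have "g u \<noteq> f u" if u: "u \<in> U" for u
  proof
    assume eq: "g u = f u"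
    let ?F = "{w \<in> U. f w = f u}" and ?E = "{w \<in> U. g w = f u}"
    have uK: "f u \<in> K" using G u eq unfolding G_def by (metis PiE)
    \<comment> \<open>The two fibres have at most \<open>card U\<close> elements in total, and
      \<open>u\<close> is counted in both, so their union misses some point \<open>w\<close> of
      \<open>U\<close>.\<close>
    have "card (?F \<union> ?E) + card (?F \<inter> ?E) = card ?F + card ?E"
      using fin by (intro card_Un_Int[symmetric]) auto
    also have "\<dots> \<le> card U" using G uK le[OF uK] by (simp add: G_def)
    finally have "card (?F \<union> ?E) + card (?F \<inter> ?E) \<le> card U" .
    moreover have "0 < card (?F \<inter> ?E)" using fin u eq by (auto simp: card_gt_0_iff)
    ultimately have "?F \<union> ?E \<noteq> U" by auto
    then obtain w where w: "w \<in> U" "f w \<noteq> f u" "g w \<noteq> f u" by blast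
    define g' where "g' = g \<circ> transpose u w"
    have tr: "transpose u w x \<in> U \<longleftrightarrow> x \<in> U" for x
      using u w by (auto simp: transpose_def)
    have "G g'"
      unfolding G_def
    proof (intro conjI ballI)
      show "g' \<in> U \<rightarrow> K" using G tr by (auto simp: G_def g'_def)
      fix c assume c: "c \<in> K"
      have "{x \<in> U. g' x = c} = transpose u w ` {x \<in> U. g x = c}"
        using tr by (auto simp: g'_def image_iff) (metis transpose_involutory)
      then have "card {x \<in> U. g' x = c} = card {x \<in> U. g x = c}"
        by (simp add: card_image)
      then show "card {x \<in> U. g' x = c} = d c" using G c by (simp add: G_def)
    qed
    \<comment> \<open>The new value at \<open>u\<close> is \<open>g w\<close>, which differs from
      \<open>f u\<close>; the new value at \<open>w\<close> is \<open>f u\<close>, which differs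
      from \<open>f w\<close>. So \<open>u\<close> stops being an agreement and \<open>w\<close>
      does not become one.\<close>
    moreover have "bad g' \<subset> bad g"
      using u w eq by (auto simp: bad_def g'_def transpose_def split: if_splits)
    then have "card (bad g') < card (bad g)"
      using fin by (intro psubset_card_mono) (auto simp: bad_def)
    ultimately show False using min by fastforce
  qed
  then show thesis using that G unfolding G_def by blast
qed

section \<open>Class sizes of the sum colouring\<close>

lemma card_ordered_pairs:
  fixes W :: "'a set"
  assumes "finite W"
  shows "card {(i, j). i \<in> W \<and> j \<in> W \<and> i \<noteq> j \<and> Q {i, j}} = 2 * card {e \<in> [W]\<^bsup>2\<^esup>. Q e}"
proof -
  let ?P = "{(i, j). i \<in> W \<and> j \<in> W \<and> i \<noteq> j \<and> Q {i, j}}"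
  let ?S = "{e \<in> [W]\<^bsup>2\<^esup>. Q e}"
  let ?h = "\<lambda>(i, j). {i, j}"
  have finP: "finite ?P" by (rule finite_subset[of _ "W \<times> W"]) (use assms in auto)
  have finS: "finite ?S" using assms by (simp add: finite_imp_finite_nsets)
  have "card {p \<in> ?P. ?h p = e} = 2" if "e \<in> ?S" for e
  proof -
    have "e \<subseteq> W" "card e = 2" "Q e" using that by (auto simp: nsets_def)
    then obtain x y where e: "e = {x, y}" "x \<noteq> y" by (auto simp: card_2_iff)
    then have "{p \<in> ?P. ?h p = e} = {(x, y), (y, x)}"
      using \<open>e \<subseteq> W\<close> \<open>Q e\<close> by (auto simp: doubleton_eq_iff insert_commute)
    then show ?thesis using e by simp
  qed
  then have "(\<Sum>e\<in>?S. \<Sum>p\<in>{p \<in> ?P. ?h p = e}. 1) = 2 * card ?S" by simp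
  moreover have "(\<Sum>e\<in>?S. \<Sum>p\<in>{p \<in> ?P. ?h p = e}. 1) = (\<Sum>p\<in>?P. 1::nat)"
    by (rule sum.group[OF finP finS]) auto
  ultimately show ?thesis by simp
qed

text \<open>For fixed \<open>i\<close>, exactly \<open>2 * t\<close> values \<open>j < n\<close>
  give residue \<open>c\<close>, and only \<open>j = 0\<close> and \<open>j = i\<close> can be lost
  on passing to edges inside \<open>{1..<n}\<close>. Over all \<open>i\<close> these losses are at
  most \<open>2 * t\<close> and \<open>4 * t\<close>; ordered pairs count each edge twice, hence
  \<open>3 * t\<close>.\<close>

lemma card_sum_colour_bounds:
  fixes k t c :: nat
  defines "n \<equiv> 2 * k * t"
  assumes c: "c < k" and t: "1 \<le> t"
  defines "e \<equiv> card {e \<in> [{1..<n}]\<^bsup>2\<^esup>. \<Sum>e mod k = c}"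
  shows "e \<le> t * (n - 1)" "t * (n - 1) \<le> e + 3 * t"
proof -
  let ?W = "{1..<n}"
  let ?R = "\<lambda>i. {j. j < n \<and> (i + j) mod k = c}"
  let ?J = "\<lambda>i. {j \<in> ?W. i \<noteq> j \<and> (i + j) mod k = c}"
  have n: "n = (2 * t) * k" by (simp add: n_def)
  have R: "card (?R i) = 2 * t" for i
    unfolding n using c by (rule card_mod_fibre)
  have "2 * e = card {(i, j). i \<in> ?W \<and> j \<in> ?W \<and> i \<noteq> j \<and> \<Sum>{i, j} mod k = c}"
    unfolding e_def by (rule card_ordered_pairs[symmetric]) simp
  also have "{(i, j). i \<in> ?W \<and> j \<in> ?W \<and> i \<noteq> j \<and> \<Sum>{i, j} mod k = c} = Sigma ?W ?J"
    by auto
  also have "card \<dots> = (\<Sum>i\<in>?W. card (?J i))" by simp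
  finally have e: "2 * e = (\<Sum>i\<in>?W. card (?J i))" .
  have "card (?J i) \<le> 2 * t" for i
    unfolding R[of i, symmetric] by (intro card_mono) auto
  then have "(\<Sum>i\<in>?W. card (?J i)) \<le> (\<Sum>i\<in>?W. 2 * t)" by (intro sum_mono)
  then show "e \<le> t * (n - 1)" unfolding e[symmetric] by (simp add: mult.commute)
  \<comment> \<open>The possible losses in row \<open>i\<close>: \<open>a i\<close> records the
    partner \<open>0\<close>, \<open>b i\<close> the partner \<open>i\<close> itself.\<close>
  define a b where "a i = (if (0 + i) mod k = c then {0::nat} else {})"
    and "b i = (if (i + i) mod k = c then {i} else {})" for i
  have "2 * t \<le> card (?J i) + (card (a i) + card (b i))" for i
  proof -
    have "?R i \<subseteq> ?J i \<union> (a i \<union> b i)" by (auto simp: a_def b_def Suc_le_eq intro: gr0I)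
    then have "card (?R i) \<le> card (?J i \<union> (a i \<union> b i))"
      by (intro card_mono) (auto simp: a_def b_def)
    also have "\<dots> \<le> card (?J i) + card (a i \<union> b i)" by (rule card_Un_le)
    also have "\<dots> \<le> card (?J i) + (card (a i) + card (b i))"
      by (intro add_left_mono card_Un_le)
    finally show ?thesis using R by simp
  qed
  then have "(\<Sum>i\<in>?W. 2 * t) \<le> (\<Sum>i\<in>?W. card (?J i) + (card (a i) + card (b i)))"
    by (intro sum_mono)
  also have "\<dots> = 2 * e + ((\<Sum>i\<in>?W. card (a i)) + (\<Sum>i\<in>?W. card (b i)))"
    by (simp add: e sum.distrib)
  also have "(\<Sum>i\<in>?W. card (a i)) \<le> 2 * t"
  proof -
    have "(\<Sum>i\<in>?W. card (a i)) = card {i \<in> ?W. (0 + i) mod k = c}"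
      by (simp add: a_def if_distrib sum.If_cases Int_def cong: if_cong)
    also have "\<dots> \<le> card (?R 0)" by (intro card_mono) auto
    finally show ?thesis using R[of 0] by linarith
  qed
  also have "(\<Sum>i\<in>?W. card (b i)) \<le> 2 * (2 * t)"
  proof -
    have "(\<Sum>i\<in>?W. card (b i)) = card {i \<in> ?W. (i + i) mod k = c}"
      by (simp add: b_def if_distrib sum.If_cases Int_def cong: if_cong)
    also have "\<dots> \<le> card {i. i < n \<and> (i + i) mod k = c}" by (intro card_mono) auto
    also have "\<dots> \<le> 2 * (2 * t)" unfolding n by (rule card_double_mod_fibre_le[OF c])
    finally show ?thesis .
  qed
  finally have "2 * (t * (n - 1)) \<le> 2 * (e + 3 * t)" by (simp add: algebra_simps)
  then show "t * (n - 1) \<le> e + 3 * t"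
    by (simp only: nat_mult_le_cancel1 zero_less_numeral)
qed

section \<open>Sums over matchings and the edges at \<open>0\<close>\<close>

lemma card_eq_sum_fibre_cards:
  assumes "finite A" "finite K" "f \<in> A \<rightarrow> K"
  shows "card A = (\<Sum>c\<in>K. card {x \<in> A. f x = c})"
proof -
  have "f ` A \<subseteq> K" using assms(3) by (simp add: image_subset_iff_funcset)
  from sum.group[OF assms(1,2) this, of "\<lambda>_. 1::nat"] show ?thesis by simp
qed

text \<open>The matching edges partition \<open>V\<close>. Taking \<open>x\<close> constantly 1
  gives the size of \<open>M\<close>; taking the identity gives the sum of the vertices.\<close>

lemma sum_over_perfect_matching:
  fixes x :: "'v \<Rightarrow> nat"
  assumes "perfect_matching V ([V]\<^bsup>2\<^esup>) M" "finite V"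
  shows "(\<Sum>e\<in>M. sum x e) = sum x V"
proof -
  have M: "M \<subseteq> [V]\<^bsup>2\<^esup>" and uniq: "\<And>v. v \<in> V \<Longrightarrow> \<exists>!e. e \<in> M \<and> v \<in> e"
    using assms by (auto simp: perfect_matching_def)
  have "finite e \<and> e \<subseteq> V" if "e \<in> M" for e using M that by (auto simp: nsets_def)
  moreover from this have "e \<inter> e' = {}" if "e \<in> M" "e' \<in> M" "e \<noteq> e'" for e e'
    using uniq that by blast
  moreover have "\<Union>M = V"
  proof (intro equalityI subsetI)
    fix v assume "v \<in> V"
    then show "v \<in> \<Union>M" using uniq by blast
  qed (use calculation(1) in blast)
  ultimately show ?thesis using sum.Union_disjoint[of M x] by simp
qed

lemma edges_split_at_0:
  fixes n :: nat
  assumes "1 \<le> n"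
  shows "complete_graph_edges n = [{1..<n}]\<^bsup>2\<^esup> \<union> (\<lambda>u. {0, u}) ` {1..<n}"
proof (intro equalityI subsetI)
  fix e assume "e \<in> complete_graph_edges n"
  then have e: "e \<subseteq> {..<n}" "finite e" "card e = 2"
    by (auto simp: complete_graph_edges_def nsets_def)
  show "e \<in> [{1..<n}]\<^bsup>2\<^esup> \<union> (\<lambda>u. {0, u}) ` {1..<n}"
  proof (cases "0 \<in> e")
    case True
    then obtain u where "e = {0, u}" "u \<noteq> 0" using e(3) by (auto simp: card_2_iff)
    then show ?thesis using e(1) by auto
  next
    case False
    then have "e \<subseteq> {1..<n}" using e(1) by (force simp: Suc_le_eq intro: gr0I)
    then show ?thesis using e by (auto simp: nsets_def)
  qed
qed (use assms in \<open>auto simp: complete_graph_edges_def nsets_def\<close>)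

section \<open>The colouring and the contradiction\<close>

theorem theorem5p3:
  fixes k t :: nat
  assumes "k \<ge> 3" and "t \<ge> 1"
  shows "\<exists>c. edge_colouring k (complete_graph_edges (2 * k * t)) c \<and>
             colour_balanced k c (complete_graph_edges (2 * k * t)) \<and>
             \<not> (\<exists>M. perfect_matching {..<2 * k * t} (complete_graph_edges (2 * k * t)) M \<and>
                    colour_balanced k c M)"
proof -
  define n where "n = 2 * k * t"
  define W where "W = {1..<n}"
  \<comment> \<open>\<open>T\<close> is the common class size of a balanced colouring,
    \<open>R\<close> the sum of the residues of the colours on a balanced perfect matching, and
    \<open>N\<close> the sum of all vertices.\<close>
  define T where "T = t * (n - 1)"
  define R N where "R = t * \<Sum>{..<k}" and "N = \<Sum>{..<n}"
  \<comment> \<open>This is \<open>R - N + u\<close> modulo \<open>k\<close>, with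
    \<open>(k - 1) * N\<close> standing for \<open>-N\<close> in the naturals.\<close>
  define f where "f u = (R + (k - 1) * N + u) mod k" for u
  define ec where "ec c = card {e \<in> [W]\<^bsup>2\<^esup>. \<Sum>e mod k = c}" for c
  \<comment> \<open>The number of edges at \<open>0\<close> that must receive residue
    \<open>c\<close>; for \<open>c < k\<close> the subtraction is exact because
    \<open>ec c \<le> T\<close>.\<close>
  define d where "d c = T - ec c" for c
  have k: "0 < k" using assms by simp
  have n2: "n = (2 * t) * k" by (simp add: n_def)
  have n1: "1 \<le> n" using assms by (simp add: n_def Suc_le_eq)
  have finW: "finite W" and cardW: "card W = n - 1" by (simp_all add: W_def)
  have ec: "ec c \<le> T" "T \<le> ec c + 3 * t" if "c < k" for c
    using card_sum_colour_bounds[OF that assms(2)] unfolding ec_def T_def W_def n_def by auto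
  have finE: "finite ([W]\<^bsup>2\<^esup>)" using finW by (simp add: finite_imp_finite_nsets)
  have "(\<Sum>c<k. ec c) = card ([W]\<^bsup>2\<^esup>)"
    unfolding ec_def using k by (intro card_eq_sum_fibre_cards[symmetric] finE) auto
  also have "\<dots> = (n - 1) choose 2" by (simp add: card_nsets cardW)
  finally have sum_ec: "(\<Sum>c<k. ec c) = (n - 1) choose 2" .
  \<comment> \<open>Both sides count the edges of the complete graph, so the deficits
    \<open>d c\<close> add up to the number of edges at \<open>0\<close>.\<close>
  have "((n - 1) choose 2) + (n - 1) = k * T"
  proof -
    obtain m where m: "n = Suc m" using n1 by (cases n) auto
    have "2 * ((m choose 2) + m) = Suc m * m"
      by (cases m) (auto simp: choose_two algebra_simps)
    also have "\<dots> = 2 * (k * (t * m))" unfolding m[symmetric] by (simp add: n_def)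
    finally show ?thesis unfolding T_def m by simp
  qed
  moreover have "(\<Sum>c<k. d c) + (\<Sum>c<k. ec c) = (\<Sum>c<k. T)"
    unfolding sum.distrib[symmetric] by (intro sum.cong) (auto simp: d_def ec)
  ultimately have sum_d: "sum d {..<k} = card W" using sum_ec cardW by simp
  \<comment> \<open>The fibre of \<open>f\<close> has at most \<open>2 * t\<close> elements and the
    deficit is at most \<open>3 * t\<close>. Since \<open>k \<ge> 3\<close> gives
    \<open>6 * t \<le> n\<close> and \<open>t \<ge> 1\<close>, the total \<open>5 * t\<close> is at
    most \<open>n - 1\<close>.\<close>
  have "card {u \<in> W. f u = c} + d c \<le> card W" if "c \<in> {..<k}" for c
  proof -
    have c: "c < k" using that by simp
    have "card {u \<in> W. f u = c} \<le> card {u. u < n \<and> (R + (k - 1) * N + u) mod k = c}"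
      by (intro card_mono) (auto simp: W_def f_def)
    also have "\<dots> = 2 * t" unfolding n2 by (rule card_mod_fibre[OF c])
    finally have "card {u \<in> W. f u = c} + d c \<le> 5 * t" using ec[OF c] by (simp add: d_def)
    moreover have "6 * t \<le> n" using assms by (simp add: n_def)
    ultimately show ?thesis using assms cardW by linarith
  qed
  then obtain g where gW: "g \<in> W \<rightarrow> {..<k}"
    and gd: "\<And>c. c \<in> {..<k} \<Longrightarrow> card {u \<in> W. g u = c} = d c"
    and gf: "\<And>u. u \<in> W \<Longrightarrow> g u \<noteq> f u"
    using exists_avoiding_map_with_fibre_cards[OF finW _ sum_d, of f] by blast
  \<comment> \<open>Residues \<open>0\<close> to \<open>k - 1\<close> are used here, and
    \<open>c\<close> shifts them to \<open>1\<close> to \<open>k\<close>. On \<open>{0, u}\<close>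
    the vertex sum is \<open>u\<close>, so \<open>val\<close> takes the value
    \<open>g u\<close>.\<close>
  define val where "val e = (if 0 \<in> e then g (\<Sum>e) else \<Sum>e mod k)" for e
  define c where "c e = Suc (val e)" for e
  have E: "complete_graph_edges n = [W]\<^bsup>2\<^esup> \<union> (\<lambda>u. {0, u}) ` W"
    unfolding W_def by (rule edges_split_at_0[OF n1])
  have no0: "0 \<notin> e" if "e \<in> [W]\<^bsup>2\<^esup>" for e using that by (auto simp: nsets_def W_def)
  have star: "val {0, u} = g u" "u \<noteq> 0" if "u \<in> W" for u
    using that by (auto simp: val_def W_def)
  have val: "val e < k" if "e \<in> complete_graph_edges n" for e
    using that k gW star no0 unfolding E by (auto simp: val_def)
  have card_val: "card {e \<in> complete_graph_edges n. val e = a} = T" if a: "a < k" for a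
  proof -
    have "{e \<in> complete_graph_edges n. val e = a} =
        {e \<in> [W]\<^bsup>2\<^esup>. \<Sum>e mod k = a} \<union> (\<lambda>u. {0, u}) ` {u \<in> W. g u = a}"
      using no0 star unfolding E by (auto simp: val_def)
    also have "card \<dots> = ec a + card ((\<lambda>u. {0, u}) ` {u \<in> W. g u = a})"
      unfolding ec_def using finE finW no0 by (intro card_Un_disjoint) auto
    also have "card ((\<lambda>u. {0, u}) ` {u \<in> W. g u = a}) = d a"
      using star(2) gd[of a] a by (subst card_image) (auto simp: inj_on_def doubleton_eq_iff)
    finally show ?thesis using ec[OF a] by (simp add: d_def)
  qed
  have fibre: "{e \<in> F. c e = i} = {e \<in> F. val e = i - 1}" if "i \<in> {1..k}" for i F
    using that by (auto simp: c_def)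
  have "edge_colouring k (complete_graph_edges n) c"
    using val by (auto simp: edge_colouring_def c_def Suc_le_eq)
  moreover have "colour_balanced k c (complete_graph_edges n)"
    unfolding colour_balanced_def
  proof (intro ballI)
    fix i j assume ij: "i \<in> {1..k}" "j \<in> {1..k}"
    then have "i - 1 < k" "j - 1 < k" by auto
    then show "card {e \<in> complete_graph_edges n. c e = i} = card {e \<in> complete_graph_edges n. c e = j}"
      unfolding fibre[OF ij(1)] fibre[OF ij(2)] by (simp add: card_val)
  qed
  moreover have False
    if M: "perfect_matching {..<n} (complete_graph_edges n) M" and bal: "colour_balanced k c M" for M
  proof -
    have ME: "M \<subseteq> complete_graph_edges n" using M by (simp add: perfect_matching_def)
    have finM: "finite M" using ME finE finW unfolding E by (auto intro: finite_subset)
    have PM: "perfect_matching {..<n} ([{..<n}]\<^bsup>2\<^esup>) M"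
      using M by (simp add: complete_graph_edges_def)
    define s where "s = card {e \<in> M. val e = 0}"
    have s: "card {e \<in> M. val e = a} = s" if "a < k" for a
    proof -
      have "Suc a \<in> {1..k}" "Suc 0 \<in> {1..k}" using that by auto
      then have "card {e \<in> M. c e = Suc a} = card {e \<in> M. c e = Suc 0}"
        using bal unfolding colour_balanced_def by blast
      then show ?thesis by (simp add: c_def s_def)
    qed
    have valM: "val \<in> M \<rightarrow> {..<k}" using val ME by auto
    have "k * s = card M"
      using card_eq_sum_fibre_cards[OF finM finite_lessThan valM] s by simp
    moreover have "2 * card M = n"
    proof -
      have "(\<Sum>e\<in>M. \<Sum>v\<in>e. 1) = (\<Sum>e\<in>M. 2::nat)"
        using ME by (intro sum.cong) (auto simp: complete_graph_edges_def nsets_def)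
      then show ?thesis using sum_over_perfect_matching[OF PM, of "\<lambda>_. 1"] by simp
    qed
    \<comment> \<open>The matching has \<open>k * t\<close> edges shared equally by \<open>k\<close>
      colours.\<close>
    ultimately have "s = t" using k by (simp add: n_def)
    have "(\<Sum>e\<in>M. val e) = (\<Sum>a<k. \<Sum>e\<in>{e \<in> M. val e = a}. val e)"
      using finM valM by (intro sum.group[symmetric]) auto
    also have "\<dots> = (\<Sum>a<k. s * a)"
      by (intro sum.cong) (auto simp: s)
    finally have sumval: "(\<Sum>e\<in>M. val e) = R"
      using \<open>s = t\<close> by (simp add: R_def sum_distrib_left)
    have "\<exists>!e. e \<in> M \<and> 0 \<in> e" using M n1 by (auto simp: perfect_matching_def)
    then obtain e0 where e0: "e0 \<in> M" "0 \<in> e0" and e0u: "\<And>e. e \<in> M \<Longrightarrow> 0 \<in> e \<Longrightarrow> e = e0"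
      by blast
    obtain u where u: "e0 = {0, u}" "u \<in> W" using e0 ME no0 unfolding E by auto
    \<comment> \<open>Vertex sum of the matching edges avoiding \<open>0\<close>, on which
      \<open>val\<close> is the residue of the edge sum. Hence \<open>R\<close> is congruent to
      \<open>g u + S\<close>, while \<open>N = u + S\<close>.\<close>
    define S where "S = (\<Sum>e\<in>M - {e0}. \<Sum>e)"
    have NS: "N = u + S"
      using sum_over_perfect_matching[OF PM, of id] sum.remove[OF finM e0(1), of "\<lambda>e. \<Sum>e"] u star(2)
      by (simp add: N_def S_def)
    have "R = g u + (\<Sum>e\<in>M - {e0}. val e)"
      using sumval sum.remove[OF finM e0(1), of val] u star(1) by simp
    also have "(\<Sum>e\<in>M - {e0}. val e) = (\<Sum>e\<in>M - {e0}. \<Sum>e mod k)"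
      using e0u by (intro sum.cong) (auto simp: val_def)
    finally have "R mod k = (g u + (\<Sum>e\<in>M - {e0}. \<Sum>e mod k) mod k) mod k"
      by (simp add: mod_add_right_eq)
    also have "\<dots> = (g u + S) mod k"
      unfolding S_def mod_sum_eq by (rule mod_add_right_eq)
    finally have "R mod k = (g u + S) mod k" .
    \<comment> \<open>Adding \<open>(k - 1) * N + u\<close> to the congruence makes
      \<open>u + S\<close> complete a multiple \<open>k * N\<close>, leaving \<open>g u\<close>, the
      residue that \<open>g\<close> was chosen to avoid at \<open>u\<close>.\<close>
    then have "f u = (g u + S + (k - 1) * N + u) mod k"
      unfolding f_def by (metis mod_add_left_eq add.assoc)
    also have "g u + S + (k - 1) * N + u = g u + k * N"
      using NS k by (cases k) auto
    finally have "f u = (g u + k * N) mod k" .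
    moreover have "g u < k" using gW u(2) by auto
    ultimately have "f u = g u" by simp
    then show False using gf[OF u(2)] by simp
  qed
  ultimately show ?thesis unfolding n_def by blast
qed

end
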